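(* Let $A$ be an $n\times n$ Hermitian non-singular matrix with polar factor $P$, and let $E$ be an $n\times n$ Hermitian matrix. Let $j'$ be any index such that $|\lambda_{j'}(P^{-1/2}EP^{-1/2})|=\max_j|\lambda_j(P^{-1/2}EP^{-1/2})|$, and let $k=\|A^{-1/2}EA^{-1/2}\|$. If for a fixed $i\in\{1,\dots,n\}$ $$\frac{|\lambda_i(A)|}{\min_l|\lambda_l(A)|}\,|\lambda_{j'}(E)|\le\|E\|,$$ then $k|\lambda_i(A)|\le\|E\|$.
   Context: All matrices are complex. $\|\cdot\|$ is the matrix 2-norm (largest singular value). For a Hermitian matrix $X$, $\lambda_1(X)\ge\dots\ge\lambda_n(X)$ are its eigenvalues in decreasing order, counted with multiplicity. The polar factor of $A$ is the positive definite matrix $P=(A^{*}A)^{1/2}$, and $P^{-1/2}$ is the inverse of its positive definite square root. For $A=V\,\mathrm{diag}(\lambda_1,\dots,\lambda_n)V^{*}$ with $V$ unitary, $A^{1/2}$ denotes any normal square root $V\,\mathrm{diag}(\lambda_1^{1/2},\dots,\lambda_n^{1/2})V^{*}$, with $\lambda_j^{1/2}$ a (possibly complex) square root of $\lambda_j$, and $A^{-1/2}=(A^{1/2})^{-1}$. *)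

theory Defs
  imports "Jordan_Normal_Form.Schur_Decomposition" "Jordan_Normal_Form.Spectral_Radius"
begin

definition hermitian_mat :: "complex mat \<Rightarrow> bool" where
  "hermitian_mat X \<longleftrightarrow> square_mat X \<and> mat_adjoint X = X"

definition unitary_mat :: "complex mat \<Rightarrow> bool" where
  "unitary_mat V \<longleftrightarrow> square_mat V \<and> mat_adjoint V * V = 1\<^sub>m (dim_row V)"

(* w \<bullet>c v conjugates v, so (X *\<^sub>v v) \<bullet>c v is v^* X v; it is real because X is Hermitian. *)
definition pos_def_mat :: "complex mat \<Rightarrow> bool" where
  "pos_def_mat X \<longleftrightarrow> hermitian_mat X \<and>
     (\<forall>v \<in> carrier_vec (dim_row X). v \<noteq> 0\<^sub>v (dim_row X) \<longrightarrow> 0 < Re ((X *\<^sub>v v) \<bullet>c v))"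

(* The positive definite square root of X is unique, hence the relational form. *)
definition pos_def_sqrt :: "complex mat \<Rightarrow> complex mat \<Rightarrow> bool" where
  "pos_def_sqrt X R \<longleftrightarrow> pos_def_mat R \<and> R * R = X"

definition polar_factor :: "complex mat \<Rightarrow> complex mat \<Rightarrow> bool" where
  "polar_factor A P \<longleftrightarrow> pos_def_sqrt (mat_adjoint A * A) P"

definition mat_inverse_of :: "complex mat \<Rightarrow> complex mat \<Rightarrow> bool" where
  "mat_inverse_of X Y \<longleftrightarrow> inverts_mat X Y \<and> inverts_mat Y X"

(* Not unique: neither the unitary diagonalization V nor the complex square roots r j of the
   eigenvalues d j are determined by A. *)
definition normal_sqrt :: "complex mat \<Rightarrow> complex mat \<Rightarrow> bool" where
  "normal_sqrt A B \<longleftrightarrow> (\<exists>V d r.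
     V \<in> carrier_mat (dim_row A) (dim_row A) \<and> unitary_mat V \<and>
     A = V * mat_diag (dim_row A) d * mat_adjoint V \<and>
     (\<forall>j < dim_row A. (r j)\<^sup>2 = d j) \<and>
     B = V * mat_diag (dim_row A) r * mat_adjoint V)"

(* Eigenvalues with algebraic multiplicity. The use of Re makes the type ordered; it loses nothing
   for Hermitian X, which is the only case in which this is meant to be used. *)
definition eigvals_decreasing :: "complex mat \<Rightarrow> real list" where
  "eigvals_decreasing X = rev (sorted_list_of_multiset (image_mset Re (proots (char_poly X))))"

(* lambda_j(X), with j counted from 1 *)
definition eigval :: "nat \<Rightarrow> complex mat \<Rightarrow> real" where
  "eigval j X = eigvals_decreasing X ! (j - 1)"

(* The eigenvalues of M^* M are real and nonnegative, so Re loses nothing. *)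
definition singular_values :: "complex mat \<Rightarrow> real set" where
  "singular_values M = (\<lambda>l. sqrt (Re l)) ` spectrum (mat_adjoint M * M)"

definition mat_norm2 :: "complex mat \<Rightarrow> real" where
  "mat_norm2 M = Max (singular_values M)"

end

theory Submission
  imports Defs
begin

text \<open>
Write \<open>A = V diag(d) V\<^sup>*\<close> and let \<open>r j\<close> be the chosen square root of \<open>d j\<close>. Since
\<open>A\<^sup>* A = V diag(\<bar>r\<bar>\<^sup>4) V\<^sup>*\<close>, uniqueness of positive definite fourth roots
(\<open>pos_def_fourth_root_unique\<close>) identifies the square root of the polar factor as \<open>V diag(\<bar>r\<bar>) V\<^sup>*\<close>.
Hence \<open>S = P\<^sup>-\<^sup>1\<^sup>/\<^sup>2\<close> and \<open>A\<^sup>-\<^sup>1\<^sup>/\<^sup>2\<close> differ only by the phases of \<open>1 / r j\<close>: there is a unitary \<open>U\<close> with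
\<open>A\<^sup>-\<^sup>1\<^sup>/\<^sup>2 = U S = S U\<close>. So \<open>A\<^sup>-\<^sup>1\<^sup>/\<^sup>2 E A\<^sup>-\<^sup>1\<^sup>/\<^sup>2 = U (S E S) U\<close> has the same 2-norm as the Hermitian matrix
\<open>S E S\<close>. That norm is the largest absolute value of an eigenvalue of \<open>S E S\<close>
(\<open>mat_norm2_unitary_diag\<close>), which is attained at the index \<open>j'\<close> by assumption.

Ostrowski's theorem (\<open>ostrowski_abs_eigval_congruence\<close>) bounds the eigenvalue of \<open>S E S\<close> at an index by
that of \<open>E\<close> at the same index times the largest eigenvalue of \<open>S\<^sup>* S\<close>, which is
\<open>1 / min \<bar>d l\<bar> = 1 / min \<bar>\<lambda>\<^sub>l(A)\<bar>\<close>. Multiplying by \<open>\<bar>\<lambda>\<^sub>i(A)\<bar>\<close> turns the hypothesis into the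
claim. Ostrowski's bound in turn rests on the spectral theorem with eigenvalues in decreasing order
(\<open>hermitian_spectral_decomposition\<close>) and on counting the equations of a homogeneous linear system
(\<open>diagonal_congruence_bound\<close>).
\<close>

section \<open>Adjoints and unitary matrices\<close>

lemma square_mult_carrier [simp]:
  "A \<in> carrier_mat n n \<Longrightarrow> B \<in> carrier_mat n m \<Longrightarrow> A * B \<in> carrier_mat n m"
  "A \<in> carrier_mat n n \<Longrightarrow> x \<in> carrier_vec n \<Longrightarrow> A *\<^sub>v x \<in> carrier_vec n"
  by auto

lemma mat_diag_dims [simp]: "dim_row (mat_diag n f) = n" "dim_col (mat_diag n f) = n"
  by (auto simp: mat_diag_def)

lemma mat_adjoint_dim [simp]:
  "dim_row (mat_adjoint A) = dim_col A" "dim_col (mat_adjoint A) = dim_row A"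
  unfolding mat_adjoint_def by auto

lemma mat_adjoint_carrier [simp]:
  "A \<in> carrier_mat m n \<Longrightarrow> mat_adjoint A \<in> carrier_mat n m"
  by (auto intro: carrier_matI)

lemma mat_adjoint_index [simp]:
  "i < dim_col A \<Longrightarrow> j < dim_row A \<Longrightarrow> mat_adjoint A $$ (i,j) = conjugate (A $$ (j,i))"
  unfolding mat_adjoint_def by (simp add: mat_of_rows_index)

lemma mat_adjoint_adjoint [simp]: "mat_adjoint (mat_adjoint A) = A"
  by (rule eq_matI) auto

lemma mat_adjoint_mult:
  assumes "A \<in> carrier_mat m n" "B \<in> carrier_mat n l"
  shows "mat_adjoint (A * B) = mat_adjoint B * mat_adjoint (A :: complex mat)"
  using assms by (intro eq_matI) (auto simp: scalar_prod_def mult.commute)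

lemma mat_adjoint_mat_diag [simp]:
  "mat_adjoint (mat_diag n f :: complex mat) = mat_diag n (\<lambda>j. cnj (f j))"
  by (rule eq_matI) (auto simp: mat_diag_def)

lemma cscalar_prod_adjoint:
  assumes "A \<in> carrier_mat m n" "v \<in> carrier_vec n" "w \<in> carrier_vec m"
  shows "(A *\<^sub>v v) \<bullet>c w = v \<bullet>c (mat_adjoint A *\<^sub>v (w :: complex vec))"
proof -
  have "(A *\<^sub>v v) \<bullet>c w = (\<Sum>i<m. \<Sum>j<n. A $$ (i,j) * v $ j * cnj (w $ i))"
    using assms by (auto simp: scalar_prod_def lessThan_atLeast0 sum_distrib_right intro!: sum.cong)
  also have "\<dots> = (\<Sum>j<n. \<Sum>i<m. A $$ (i,j) * v $ j * cnj (w $ i))"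
    by (rule sum.swap)
  also have "\<dots> = v \<bullet>c (mat_adjoint A *\<^sub>v w)"
    using assms by (auto simp: scalar_prod_def lessThan_atLeast0 sum_distrib_left ac_simps intro!: sum.cong)
  finally show ?thesis .
qed

lemma unitary_matD:
  assumes "V \<in> carrier_mat n n" "unitary_mat V"
  shows "mat_adjoint V * V = 1\<^sub>m n" "V * mat_adjoint V = 1\<^sub>m n"
proof -
  show 1: "mat_adjoint V * V = 1\<^sub>m n" using assms by (auto simp: unitary_mat_def)
  show "V * mat_adjoint V = 1\<^sub>m n"
    using mat_mult_left_right_inverse[OF _ assms(1) 1] assms(1) by simp
qed

lemma unitary_matI:
  "V \<in> carrier_mat n n \<Longrightarrow> mat_adjoint V * V = 1\<^sub>m n \<Longrightarrow> unitary_mat V"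
  by (auto simp: unitary_mat_def)

lemma unitary_mat_cancel:
  assumes "V \<in> carrier_mat n n" "unitary_mat V" "B \<in> carrier_mat n m"
  shows "mat_adjoint V * (V * B) = B" "V * (mat_adjoint V * B) = B"
  using assms unitary_matD[OF assms(1,2)]
  by (simp_all add: assoc_mult_mat[of _ n n _ n _ m, symmetric])

lemma unitary_mat_adjoint:
  assumes "V \<in> carrier_mat n n" "unitary_mat V"
  shows "unitary_mat (mat_adjoint V)"
  using assms unitary_matD[OF assms] by (intro unitary_matI[of _ n]) auto

lemma unitary_mat_mult:
  assumes "V \<in> carrier_mat n n" "unitary_mat V" "W \<in> carrier_mat n n" "unitary_mat W"
  shows "unitary_mat (V * W)"
  using assms unitary_matD[OF assms(3,4)]
  by (intro unitary_matI[of _ n])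
     (simp_all add: mat_adjoint_mult[of _ n n _ n] assoc_mult_mat[of _ n n _ n _ n] unitary_mat_cancel[of _ n _ n])

lemma hermitian_matD:
  "A \<in> carrier_mat n n \<Longrightarrow> hermitian_mat A \<Longrightarrow> mat_adjoint A = A"
  by (simp add: hermitian_mat_def)

lemma hermitian_mat_congruence:
  assumes "A \<in> carrier_mat n n" "hermitian_mat A" "W \<in> carrier_mat n n"
  shows "hermitian_mat (mat_adjoint W * A * W)"
  using assms hermitian_matD[OF assms(1,2)]
  by (simp add: hermitian_mat_def mat_adjoint_mult[of _ n n _ n] assoc_mult_mat[of _ n n _ n _ n])

lemma cscalar_prod_self_of_real:
  "v \<bullet>c v = complex_of_real (\<Sum>j<dim_vec v. (cmod (v $ j))\<^sup>2)"
  by (auto simp: scalar_prod_def lessThan_atLeast0 complex_norm_square[symmetric] intro!: sum.cong)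

section \<open>Unitary diagonalization of Hermitian matrices\<close>

text \<open>Gram--Schmidt applied to a basis that starts with \<open>v\<close> keeps the direction of its first vector;
normalizing the orthogonal columns turns them into a unitary matrix.\<close>

lemma unitary_completion:
  fixes v :: "complex vec"
  assumes v: "v \<in> carrier_vec n" "v \<noteq> 0\<^sub>v n"
  obtains W a where "W \<in> carrier_mat n n" "unitary_mat W" "col W 0 = a \<cdot>\<^sub>v v"
proof -
  interpret cof_vec_space n "TYPE(complex)" .
  define b where "b = basis_completion v"
  define ws where "ws = gram_schmidt n b"
  from basis_completion[OF v, folded b_def]
  have dist_b: "distinct b" and indep: "\<not> lin_dep (set b)" and b: "set b \<subseteq> carrier_vec n"
    and hdb: "hd b = v" and len_b: "length b = n"
    by auto
  have n: "n > 0" using v by (cases n) (auto intro!: eq_vecI)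
  with hdb len_b obtain vs where bv: "b = v # vs" by (cases b) auto
  from gram_schmidt_result[OF b dist_b indep ws_def]
  have ws: "set ws \<subseteq> carrier_vec n" "corthogonal ws" "length ws = n"
    by (auto simp: len_b)
  from gram_schmidt_hd[OF v(1), of vs, folded bv] have hdws: "hd ws = v"
    unfolding ws_def .
  define c where "c w = complex_of_real (1 / sqrt (\<Sum>j<n. (cmod (w $ j))\<^sup>2))" for w
  define W where "W = mat_of_cols n (map (\<lambda>w. c w \<cdot>\<^sub>v w) ws)"
  have wsi: "ws ! i \<in> carrier_vec n" if "i < n" for i
    using ws that by auto
  have colW: "col W i = c (ws ! i) \<cdot>\<^sub>v ws ! i" if "i < n" for i
    using that ws wsi[OF that] unfolding W_def by simp
  have W: "W \<in> carrier_mat n n" using ws(3) by (auto simp: W_def intro: carrier_matI)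
  have pos: "0 < (\<Sum>j<n. (cmod (ws ! i $ j))\<^sup>2)" if "i < n" for i
  proof -
    have "ws ! i \<bullet>c ws ! i \<noteq> 0" using corthogonalD[OF ws(2), of i i] ws(3) that by auto
    hence "(\<Sum>j<n. (cmod (ws ! i $ j))\<^sup>2) \<noteq> 0"
      using wsi[OF that] unfolding cscalar_prod_self_of_real by (auto simp del: of_real_sum)
    moreover have "0 \<le> (\<Sum>j<n. (cmod (ws ! i $ j))\<^sup>2)" by (intro sum_nonneg) auto
    ultimately show ?thesis by linarith
  qed
  have "mat_adjoint W * W = 1\<^sub>m n"
  proof (rule eq_matI)
    fix i j assume "i < dim_row (1\<^sub>m n)" "j < dim_col (1\<^sub>m n)"
    hence ij: "i < n" "j < n" by auto
    have "(mat_adjoint W * W) $$ (i,j) = col W j \<bullet>c col W i"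
      using ij W by (auto simp: scalar_prod_def mult.commute intro!: sum.cong)
    also have "\<dots> = c (ws ! j) * cnj (c (ws ! i)) * (ws ! j \<bullet>c ws ! i)"
      using ij wsi[OF ij(1)] wsi[OF ij(2)]
      by (simp add: colW conjugate_smult_vec)
    also have "\<dots> = (1\<^sub>m n) $$ (i,j)"
    proof (cases "i = j")
      case True
      have "c (ws ! i) * cnj (c (ws ! i)) * (ws ! i \<bullet>c ws ! i) = 1"
        using pos[OF ij(1)] wsi[OF ij(1)]
        unfolding cscalar_prod_self_of_real c_def
        by (simp add: of_real_mult[symmetric] del: of_real_mult of_real_sum of_real_divide of_real_power)
      with True ij show ?thesis by simp
    next
      case False
      have "ws ! j \<bullet>c ws ! i = 0" using corthogonalD[OF ws(2), of j i] ws(3) ij False by auto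
      with False ij show ?thesis by simp
    qed
    finally show "(mat_adjoint W * W) $$ (i,j) = (1\<^sub>m n) $$ (i,j)" .
  qed (use W in auto)
  hence "unitary_mat W" using W by (intro unitary_matI)
  moreover have "ws ! 0 = v" using hdws ws(3) n by (cases ws) auto
  ultimately show ?thesis using that[OF W] colW[OF n] by auto
qed

lemma mat_diag_Cons:
  "mat_diag (Suc m) (\<lambda>j. (e # es) ! j) =
     four_block_mat (mat 1 1 (\<lambda>_. e)) (0\<^sub>m 1 m) (0\<^sub>m m 1) (mat_diag m (\<lambda>j. es ! j))"
  by (rule eq_matI) (auto simp: mat_diag_def nth_Cons')

text \<open>Deflation. An eigenvector for the first prescribed root \<open>e\<close> is completed to a unitary \<open>W\<close>. The first
column of \<open>W\<^sup>* A W\<close> is then \<open>e\<close> times a unit vector, and by Hermitian symmetry so is its first row. What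
remains is a smaller Hermitian block whose characteristic polynomial has lost exactly the factor of
\<open>e\<close>. Prescribing the list of roots makes the eigenvalues appear on the diagonal in any wanted order.\<close>

lemma hermitian_unitary_diagonalization:
  assumes "A \<in> carrier_mat n n" "hermitian_mat A" "char_poly A = (\<Prod>e\<leftarrow>es. [:- e, 1:])"
  shows "\<exists>V. V \<in> carrier_mat n n \<and> unitary_mat V \<and> A = V * mat_diag n (\<lambda>j. es ! j) * mat_adjoint V"
  using assms
proof (induct es arbitrary: n A)
  case Nil
  with degree_monic_char_poly[of A n] have "n = 0" by auto
  with Nil show ?case
    by (intro exI[of _ "1\<^sub>m 0"]) (auto intro!: unitary_matI[of _ 0] eq_matI)
next
  case (Cons e es n A)
  note A = Cons(2) and hA = Cons(3) and cp = Cons(4)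
  have "eigenvalue A e"
    unfolding eigenvalue_root_char_poly[OF A] cp by simp
  then obtain v where v: "v \<in> carrier_vec n" "v \<noteq> 0\<^sub>v n" "A *\<^sub>v v = e \<cdot>\<^sub>v v"
    using A unfolding eigenvalue_def eigenvector_def by auto
  have "n > 0" using v(1,2) by (cases n) (auto intro!: eq_vecI)
  then obtain m where n: "n = Suc m" by (cases n) auto
  from unitary_completion[OF v(1,2)] obtain W a where
    W: "W \<in> carrier_mat n n" "unitary_mat W" and a: "col W 0 = a \<cdot>\<^sub>v v" by metis
  note WW = unitary_matD[OF W]
  define B where "B = mat_adjoint W * A * W"
  have B: "B \<in> carrier_mat n n" using A W by (auto simp: B_def)
  have hB: "hermitian_mat B" unfolding B_def using A hA W(1) by (rule hermitian_mat_congruence)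
  have AB: "A = W * B * mat_adjoint W"
    using A W WW unfolding B_def
    by (simp add: assoc_mult_mat[of _ n n _ n _ n] unitary_mat_cancel[of _ n _ n])
  have Aa: "A *\<^sub>v col W 0 = e \<cdot>\<^sub>v col W 0"
    using v A W by (simp add: a mult_mat_vec[of A n n v] smult_smult_assoc mult.commute)
  have col0: "B $$ (i,0) = (if i = 0 then e else 0)" if "i < n" for i
  proof -
    have "B $$ (i,0) = row (mat_adjoint W) i \<bullet> (A *\<^sub>v col W 0)"
      using A W that n unfolding B_def
      by (simp add: assoc_mult_mat[of _ n n _ n _ n] mult_mat_vec_def)
    also have "\<dots> = e * (mat_adjoint W * W) $$ (i,0)"
      unfolding Aa using W that n by simp
    finally show ?thesis unfolding WW using that n by simp
  qed
  have herm: "B $$ (i,j) = cnj (B $$ (j,i))" if "i < n" "j < n" for i j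
    using arg_cong[OF hermitian_matD[OF B hB], of "\<lambda>X. X $$ (i,j)"] that B by simp
  have row0: "B $$ (0,i) = (if i = 0 then e else 0)" if "i < n" for i
    using herm[of 0 i] herm[of 0 0] col0[OF that] col0[of 0] n that by (auto split: if_splits)
  define C where "C = mat m m (\<lambda>(i,j). B $$ (Suc i, Suc j))"
  let ?e = "mat 1 1 (\<lambda>_. e)"
  have C: "C \<in> carrier_mat m m" by (simp add: C_def)
  have BC: "B = four_block_mat ?e (0\<^sub>m 1 m) (0\<^sub>m m 1) C"
    using B n col0 row0 by (intro eq_matI) (auto simp: C_def)
  have hC: "hermitian_mat C"
    using herm[symmetric] n unfolding hermitian_mat_def by (auto simp: C_def intro!: eq_matI)
  have "similar_mat_wit A B W (mat_adjoint W)"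
    using A B W WW AB by (intro similar_mat_witI[of _ _ n]) auto
  hence "char_poly A = char_poly B"
    using char_poly_similar unfolding similar_mat_def by blast
  also have "\<dots> = char_poly ?e * char_poly C"
    unfolding BC by (rule char_poly_four_block_zeros_col[OF _ _ C]) auto
  also have "char_poly ?e = [:- e, 1:]"
    by (simp add: char_poly_defs det_def sign_def)
  finally have "[:- e, 1:] * char_poly C = [:- e, 1:] * (\<Prod>e\<leftarrow>es. [:- e, 1:])"
    using cp by simp
  hence "char_poly C = (\<Prod>e\<leftarrow>es. [:- e, 1:])"
    by (metis mult_cancel_left pCons_eq_0_iff zero_neq_one)
  from Cons(1)[OF C hC this] obtain X where X: "X \<in> carrier_mat m m" "unitary_mat X"
    and CX: "C = X * mat_diag m (\<lambda>j. es ! j) * mat_adjoint X" by auto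
  define G where "G = four_block_mat (1\<^sub>m 1) (0\<^sub>m 1 m) (0\<^sub>m m 1) X"
  have G: "G \<in> carrier_mat n n" using X n by (auto simp: G_def intro: carrier_matI)
  have aG: "mat_adjoint G = four_block_mat (1\<^sub>m 1) (0\<^sub>m 1 m) (0\<^sub>m m 1) (mat_adjoint X)"
    using X by (intro eq_matI) (auto simp: G_def)
  have "mat_adjoint G * G = four_block_mat (1\<^sub>m 1) (0\<^sub>m 1 m) (0\<^sub>m m 1) (1\<^sub>m m)"
    unfolding aG unfolding G_def
    using X unitary_matD[OF X]
    by (subst mult_four_block_mat[of _ 1 1 _ m _ m _ _ 1 _ m]) auto
  hence uG: "unitary_mat G" using G n by (intro unitary_matI[of _ n]) auto
  let ?D = "mat_diag n (\<lambda>j. (e # es) ! j)"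
  have De: "mat_diag m (\<lambda>j. es ! j) \<in> carrier_mat m m" by simp
  have GD: "G * ?D = four_block_mat ?e (0\<^sub>m 1 m) (0\<^sub>m m 1) (X * mat_diag m (\<lambda>j. es ! j))"
    unfolding G_def mat_diag_Cons n
    using X De by (subst mult_four_block_mat[of _ 1 1 _ m _ m _ _ 1 _ m]) auto
  have GDG: "G * ?D * mat_adjoint G = B"
    unfolding GD aG BC CX
    using X De by (subst mult_four_block_mat[of _ 1 1 _ m _ m _ _ 1 _ m]) auto
  have D: "?D \<in> carrier_mat n n" by simp
  have "A = (W * G) * ?D * mat_adjoint (W * G)"
    unfolding AB GDG[symmetric] using W G D
    by (simp add: assoc_mult_mat[of _ n n _ n _ n] mat_adjoint_mult[of _ n n _ n])
  thus ?case using W G uG unitary_mat_mult[OF W G uG] by (intro exI[of _ "W * G"]) auto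
qed

section \<open>Eigenvalues in decreasing order\<close>

lemma unitary_diagonalization_inverse:
  assumes "V \<in> carrier_mat n n" "unitary_mat V"
  shows "mat_adjoint V * (V * mat_diag n d * mat_adjoint V) * V = mat_diag n d"
  using assms unitary_matD[OF assms] mat_diag_dim[of n d]
  by (simp add: assoc_mult_mat[of _ n n _ n _ n] unitary_mat_cancel[of _ n _ n])

text \<open>For fixed unitary \<open>V\<close>, the matrices \<open>V diag(d) V\<^sup>*\<close> compute like the functions \<open>d\<close>:
products and adjoints are pointwise.\<close>

lemma unitary_diagonalization_mult:
  assumes "V \<in> carrier_mat n n" "unitary_mat V"
  shows "(V * mat_diag n d * mat_adjoint V) * (V * mat_diag n e * mat_adjoint V)
           = V * mat_diag n (\<lambda>j. d j * e j) * mat_adjoint V"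
proof -
  have D: "mat_diag n d \<in> carrier_mat n n" "mat_diag n e \<in> carrier_mat n n" by auto
  have "(V * mat_diag n d * mat_adjoint V) * (V * mat_diag n e * mat_adjoint V)
      = V * (mat_diag n d * mat_diag n e) * mat_adjoint V"
    using assms D by (simp add: assoc_mult_mat[of _ n n _ n _ n] unitary_mat_cancel[of _ n _ n] del: mat_diag_diag)
  thus ?thesis by simp
qed

lemma mat_adjoint_unitary_diagonalization:
  assumes "V \<in> carrier_mat n n"
  shows "mat_adjoint (V * mat_diag n d * mat_adjoint V) = V * mat_diag n (\<lambda>j. cnj (d j)) * mat_adjoint V"
proof -
  have D: "mat_diag n d \<in> carrier_mat n n" "mat_diag n (\<lambda>j. cnj (d j)) \<in> carrier_mat n n" by auto
  show ?thesis using assms D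
    by (simp add: assoc_mult_mat[of _ n n _ n _ n] mat_adjoint_mult[of _ n n _ n])
qed

lemma mat_diag_eqD: "mat_diag n d = mat_diag n e \<Longrightarrow> j < n \<Longrightarrow> d j = e j"
  by (drule arg_cong[of _ _ "\<lambda>X. X $$ (j,j)"]) (simp add: mat_diag_def)

lemma hermitian_unitary_diagonalization_real:
  assumes "V \<in> carrier_mat n n" "unitary_mat V"
    and "hermitian_mat (V * mat_diag n d * mat_adjoint V)" and "j < n"
  shows "complex_of_real (Re (d j)) = d j"
proof -
  have "V * mat_diag n (\<lambda>j. cnj (d j)) * mat_adjoint V = V * mat_diag n d * mat_adjoint V"
    using assms(3) mat_adjoint_unitary_diagonalization[OF assms(1), of d] by (simp add: hermitian_mat_def)
  hence "mat_diag n (\<lambda>j. cnj (d j)) = mat_diag n d"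
    using unitary_diagonalization_inverse[OF assms(1,2)] by metis
  from mat_diag_eqD[OF this assms(4)] show ?thesis by (simp add: complex_eq_iff)
qed

lemma char_poly_unitary_diagonalization:
  assumes V: "V \<in> carrier_mat n n" "unitary_mat V"
  shows "char_poly (V * mat_diag n d * mat_adjoint V) = (\<Prod>a\<leftarrow>map d [0..<n]. [:- a, 1:])"
proof -
  let ?D = "mat_diag n d"
  have D: "?D \<in> carrier_mat n n" by simp
  have "similar_mat_wit (V * ?D * mat_adjoint V) ?D V (mat_adjoint V)"
    using V D unitary_matD[OF V] by (intro similar_mat_witI[of _ _ n]) auto
  hence "char_poly (V * ?D * mat_adjoint V) = char_poly ?D"
    using char_poly_similar unfolding similar_mat_def by blast
  also have "\<dots> = (\<Prod>a\<leftarrow>diag_mat ?D. [:- a, 1:])"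
    by (rule char_poly_upper_triangular[OF D]) (auto simp: mat_diag_def)
  also have "diag_mat ?D = map d [0..<n]"
    by (auto simp: diag_mat_def mat_diag_def)
  finally show ?thesis .
qed

lemma proots_prod_linear_factors:
  "proots (\<Prod>a\<leftarrow>as. [:- a, 1:]) = mset (as :: 'a :: idom list)"
  proof (induct as)
  case (Cons a as)
  have "(\<Prod>a\<leftarrow>as. [:- a, 1:]) \<noteq> (0 :: 'a poly)" by (auto simp: prod_list_zero_iff)
  with Cons show ?case by (simp add: proots_mult del: mult_pCons_left)
qed simp

lemma mset_eigvals_decreasing:
  assumes "char_poly A = (\<Prod>a\<leftarrow>as. [:- a, 1:])"
  shows "mset (eigvals_decreasing A) = mset (map Re as)"
  by (simp add: eigvals_decreasing_def assms proots_prod_linear_factors)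

lemma length_eigvals_decreasing:
  assumes "A \<in> carrier_mat n n"
  shows "length (eigvals_decreasing A) = n"
proof -
  have "size (mset (eigvals_decreasing A)) = size (proots (char_poly A))"
    unfolding eigvals_decreasing_def by simp
  thus ?thesis using degree_monic_char_poly[OF assms] by (simp add: size_proots_complex)
qed

lemma eigval_antimono:
  assumes "A \<in> carrier_mat n n" "i \<le> j" "j < n"
  shows "eigval (Suc j) A \<le> eigval (Suc i) A"
  using sorted_rev_nth_mono[of "eigvals_decreasing A" i j] assms length_eigvals_decreasing[OF assms(1)]
  by (simp add: eigval_def eigvals_decreasing_def)

lemma eigval_image_unitary_diagonalization:
  assumes "V \<in> carrier_mat n n" "unitary_mat V"
  shows "(\<lambda>l. eigval l (V * mat_diag n d * mat_adjoint V)) ` {1..n} = (\<lambda>j. Re (d j)) ` {..<n}"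
proof -
  let ?A = "V * mat_diag n d * mat_adjoint V"
  have len: "length (eigvals_decreasing ?A) = n"
    using assms by (intro length_eigvals_decreasing) auto
  have "(\<lambda>l. eigval l ?A) ` {1..n} = (\<lambda>j. eigvals_decreasing ?A ! j) ` {..<n}"
    unfolding eigval_def image_Suc_lessThan[symmetric] image_image by simp
  also have "\<dots> = set (eigvals_decreasing ?A)"
    using len by (auto simp: set_conv_nth)
  also have "\<dots> = set (map Re (map d [0..<n]))"
    using mset_eigvals_decreasing[OF char_poly_unitary_diagonalization[OF assms], of d]
    by (metis set_mset_mset)
  finally show ?thesis by (simp add: image_image lessThan_atLeast0)
qed

text \<open>The spectral theorem in the form used throughout: the diagonal lists the eigenvalues in decreasing
order. A first diagonalization, in some order, is needed to see that the roots of the characteristic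
polynomial are real; only then is the decreasing list of their real parts a list of the roots, so
that it can be prescribed as the diagonal.\<close>

lemma hermitian_spectral_decomposition:
  assumes A: "A \<in> carrier_mat n n" "hermitian_mat A"
  obtains V where "V \<in> carrier_mat n n" "unitary_mat V"
    "A = V * mat_diag n (\<lambda>j. complex_of_real (eigval (Suc j) A)) * mat_adjoint V"
proof -
  from char_poly_factorized[OF A(1)] obtain as where
    as: "char_poly A = (\<Prod>a\<leftarrow>as. [:- a, 1:])" "length as = n" by auto
  from hermitian_unitary_diagonalization[OF A as(1)] obtain W where
    W: "W \<in> carrier_mat n n" "unitary_mat W"
    and AW: "A = W * mat_diag n (\<lambda>j. as ! j) * mat_adjoint W" by auto
  have "complex_of_real (Re (as ! j)) = as ! j" if "j < n" for j
    using hermitian_unitary_diagonalization_real[OF W _ that, of "\<lambda>j. as ! j"] A(2) AW by simp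
  hence re: "map (complex_of_real \<circ> Re) as = as"
    using as(2) by (intro nth_equalityI) auto
  define es where "es = map complex_of_real (eigvals_decreasing A)"
  have "mset es = mset (map (complex_of_real \<circ> Re) as)"
    using mset_eigvals_decreasing[OF as(1)] by (simp add: es_def multiset.map_comp)
  hence "mset (map (\<lambda>a. [:- a, 1:]) es) = mset (map (\<lambda>a. [:- a, 1:]) as)"
    unfolding re by simp
  hence "char_poly A = (\<Prod>a\<leftarrow>es. [:- a, 1:])"
    unfolding as(1) by (metis prod_mset_prod_list)
  from hermitian_unitary_diagonalization[OF A this] obtain V where
    V: "V \<in> carrier_mat n n" "unitary_mat V"
    and AV: "A = V * mat_diag n (\<lambda>j. es ! j) * mat_adjoint V" by auto
  have "mat_diag n (\<lambda>j. es ! j) = mat_diag n (\<lambda>j. complex_of_real (eigval (Suc j) A))"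
    using length_eigvals_decreasing[OF A(1)]
    by (intro eq_matI) (auto simp: mat_diag_def es_def eigval_def)
  with V AV that show ?thesis by metis
qed

section \<open>Ostrowski's bound\<close>

text \<open>Padding the rows with zero rows to a square matrix makes its determinant vanish.\<close>

lemma homogeneous_system_nontrivial:
  fixes rs :: "'a :: field vec list"
  assumes rs: "set rs \<subseteq> carrier_vec n" and len: "length rs < n"
  obtains c where "c \<in> carrier_vec n" "c \<noteq> 0\<^sub>v n" "\<And>r. r \<in> set rs \<Longrightarrow> r \<bullet> c = 0"
proof -
  define M where "M = mat_of_rows n (rs @ replicate (n - length rs) (0\<^sub>v n))"
  have M: "M \<in> carrier_mat n n" using len by (auto simp: M_def intro: carrier_matI)
  have rowM: "row M i = rs ! i" if "i < length rs" for i
    using that rs len unfolding M_def by (subst mat_of_rows_row) (auto simp: nth_append)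
  have zero: "row M (n - 1) = 0\<^sub>v n"
    using len unfolding M_def by (subst mat_of_rows_row) (auto simp: nth_append)
  have "M $$ (n - 1, i) = 0" if "i < n" for i
    using arg_cong[OF zero, of "\<lambda>v. v $ i"] that M by simp
  hence "transpose_mat M *\<^sub>v unit_vec n (n - 1) = 0\<^sub>v n"
    using M len by (intro eq_vecI) auto
  moreover have "unit_vec n (n - 1) \<noteq> (0\<^sub>v n :: 'a vec)"
    using len by (auto simp: unit_vec_def vec_eq_iff)
  ultimately have "det (transpose_mat M) = 0"
    using M by (subst det_0_iff_vec_prod_zero_field[of _ n]) (auto intro!: exI[of _ "unit_vec n (n - 1)"])
  hence "det M = 0" using det_transpose[OF M] by simp
  then obtain c where c: "c \<in> carrier_vec n" "c \<noteq> 0\<^sub>v n" "M *\<^sub>v c = 0\<^sub>v n"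
    using det_0_iff_vec_prod_zero_field[OF M] by auto
  have "r \<bullet> c = 0" if "r \<in> set rs" for r
  proof -
    from that obtain i where i: "i < length rs" "r = rs ! i" by (auto simp: in_set_conv_nth)
    thus ?thesis using arg_cong[OF c(3), of "\<lambda>v. v $ i"] M len by (simp add: rowM)
  qed
  with c show ?thesis using that by blast
qed

lemma unitary_mat_isometry:
  assumes "V \<in> carrier_mat n n" "unitary_mat V" "x \<in> carrier_vec n"
  shows "(V *\<^sub>v x) \<bullet>c (V *\<^sub>v x) = x \<bullet>c x"
  using assms unitary_matD[OF assms(1,2)]
  by (simp add: cscalar_prod_adjoint[of V n n] assoc_mult_mat_vec[of _ n n _ n, symmetric])

lemma mat_diag_mult_vec:
  "x \<in> carrier_vec n \<Longrightarrow> mat_diag n d *\<^sub>v x = vec n (\<lambda>j. d j * x $ j)"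
  by (intro eq_vecI) (auto simp: mat_diag_def scalar_prod_def if_distrib[of "\<lambda>t. t * _"] cong: if_cong)

lemma mat_diag_form:
  assumes "x \<in> carrier_vec n"
  shows "(mat_diag n (\<lambda>j. complex_of_real (f j)) *\<^sub>v x) \<bullet>c x = complex_of_real (\<Sum>j<n. f j * (cmod (x $ j))\<^sup>2)"
  using assms
  by (auto simp: mat_diag_mult_vec scalar_prod_def lessThan_atLeast0 complex_norm_square[symmetric] mult.assoc intro!: sum.cong)

text \<open>The dimension count behind Courant--Fischer. Asking a vector \<open>c\<close> to be supported on \<open>I\<close> and \<open>Q c\<close> to
vanish on \<open>J\<close> imposes \<open>n - card I + card J < n\<close> linear equations, so some \<open>c \<noteq> 0\<close> satisfies them.
For this \<open>c\<close> the common value of the two quadratic forms is at least \<open>\<mu> \<parallel>c\<parallel>\<^sup>2\<close> and at most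
\<open>\<phi> \<parallel>Q c\<parallel>\<^sup>2\<close>. Since this value is positive, so is \<open>\<phi>\<close>, and \<open>\<parallel>Q c\<parallel>\<^sup>2 \<le> s \<parallel>c\<parallel>\<^sup>2\<close> gives the bound.\<close>

lemma diagonal_congruence_bound:
  fixes d f :: "nat \<Rightarrow> real"
  assumes Q: "Q \<in> carrier_mat n n"
    and D: "mat_diag n (\<lambda>j. complex_of_real (d j)) = mat_adjoint Q * mat_diag n (\<lambda>j. complex_of_real (f j)) * Q"
    and bound: "\<And>x. x \<in> carrier_vec n \<Longrightarrow> Re ((Q *\<^sub>v x) \<bullet>c (Q *\<^sub>v x)) \<le> s * Re (x \<bullet>c x)"
    and IJ: "I \<subseteq> {..<n}" "J \<subseteq> {..<n}" "card J < card I"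
    and d: "\<And>j. j \<in> I \<Longrightarrow> \<mu> \<le> d j"
    and f: "\<And>j. j < n \<Longrightarrow> j \<notin> J \<Longrightarrow> f j \<le> \<phi>"
    and "0 < \<mu>"
  shows "\<mu> \<le> s * \<phi>"
proof -
  have fin: "finite I" "finite J" using IJ finite_subset by auto
  \<comment> \<open>The unit vectors encode the support condition, the rows of \<open>Q\<close> the vanishing of \<open>Q c\<close> on \<open>J\<close>.\<close>
  define rs where "rs = map (unit_vec n) (sorted_list_of_set ({..<n} - I)) @ map (row Q) (sorted_list_of_set J)"
  have rs: "set rs \<subseteq> carrier_vec n" using Q by (auto simp: rs_def)
  have "card I \<le> n" using card_mono[OF _ IJ(1)] by simp
  hence "length rs < n"
    using IJ fin by (simp add: rs_def card_Diff_subset)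
  from homogeneous_system_nontrivial[OF rs this] obtain c where
    c: "c \<in> carrier_vec n" "c \<noteq> 0\<^sub>v n" and rc: "\<And>r. r \<in> set rs \<Longrightarrow> r \<bullet> c = 0" by blast
  have cI: "c $ j = 0" if "j < n" "j \<notin> I" for j
    using rc[of "unit_vec n j"] that c fin by (auto simp: rs_def)
  define g where "g = Q *\<^sub>v c"
  have g: "g \<in> carrier_vec n" using Q c by (simp add: g_def)
  have gJ: "g $ j = 0" if "j \<in> J" for j
    using rc[of "row Q j"] that Q fin IJ(2) by (auto simp: rs_def g_def)
  define N where "N v = (\<Sum>j<n. (cmod (v $ j))\<^sup>2)" for v :: "complex vec"
  have N: "Re (v \<bullet>c v) = N v" if "v \<in> carrier_vec n" for v
    using that by (simp add: cscalar_prod_self_of_real N_def)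
  have F: "mat_diag n (\<lambda>j. complex_of_real (f j)) \<in> carrier_mat n n" by simp
  have "c \<bullet>c c \<noteq> 0" using c by simp
  moreover have "0 \<le> N c" unfolding N_def by (intro sum_nonneg) auto
  ultimately have Nc: "0 < N c"
    using c(1) by (auto simp: cscalar_prod_self_of_real N_def less_le simp del: of_real_sum)
  have "complex_of_real (\<Sum>j<n. d j * (cmod (c $ j))\<^sup>2)
      = (mat_adjoint Q *\<^sub>v (mat_diag n (\<lambda>j. complex_of_real (f j)) *\<^sub>v g)) \<bullet>c c"
    unfolding mat_diag_form[OF c(1), symmetric] D g_def using Q F c
    by (simp add: assoc_mult_mat_vec[of _ n n _ n])
  also have "\<dots> = (mat_diag n (\<lambda>j. complex_of_real (f j)) *\<^sub>v g) \<bullet>c g"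
    using Q F g c by (subst cscalar_prod_adjoint[of _ n n]) (auto simp: g_def)
  also have "\<dots> = complex_of_real (\<Sum>j<n. f j * (cmod (g $ j))\<^sup>2)"
    by (rule mat_diag_form[OF g])
  finally have eq: "(\<Sum>j<n. d j * (cmod (c $ j))\<^sup>2) = (\<Sum>j<n. f j * (cmod (g $ j))\<^sup>2)"
    by (simp only: of_real_eq_iff)
  have "\<mu> * N c \<le> (\<Sum>j<n. d j * (cmod (c $ j))\<^sup>2)"
    unfolding N_def sum_distrib_left
  proof (rule sum_mono)
    fix j assume "j \<in> {..<n}"
    thus "\<mu> * (cmod (c $ j))\<^sup>2 \<le> d j * (cmod (c $ j))\<^sup>2"
      using d[of j] cI[of j] by (cases "j \<in> I") (auto intro: mult_right_mono)
  qed
  also have "\<dots> \<le> \<phi> * N g"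
    unfolding eq N_def sum_distrib_left
  proof (rule sum_mono)
    fix j assume "j \<in> {..<n}"
    thus "f j * (cmod (g $ j))\<^sup>2 \<le> \<phi> * (cmod (g $ j))\<^sup>2"
      using f[of j] gJ[of j] by (cases "j \<in> J") (auto intro: mult_right_mono)
  qed
  finally have le: "\<mu> * N c \<le> \<phi> * N g" .
  have "0 < \<mu> * N c" using Nc \<open>0 < \<mu>\<close> by simp
  hence "0 < \<phi> * N g" using le by linarith
  moreover have "0 \<le> N g" unfolding N_def by (intro sum_nonneg) auto
  ultimately have "0 < \<phi>" by (simp add: zero_less_mult_iff)
  hence "\<phi> * N g \<le> \<phi> * (s * N c)"
    using bound[OF c(1), folded g_def] N[OF g] N[OF c(1)] by simp
  with le have "\<mu> * N c \<le> (s * \<phi>) * N c" by (simp add: ac_simps)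
  with Nc show ?thesis by simp
qed

text \<open>The upper bound in Ostrowski's theorem. In eigenbases of \<open>E\<close> and of \<open>S\<^sup>* E S\<close> the congruence by \<open>S\<close>
becomes a congruence \<open>Q\<close> between the two diagonal matrices of eigenvalues, with the same norm bound.
A positive eigenvalue is compared through the largest \<open>j + 1\<close> eigenvalues, a negative one through the
smallest ones after changing the sign of both forms.\<close>

lemma ostrowski_abs_eigval_congruence:
  assumes E: "E \<in> carrier_mat n n" "hermitian_mat E" and S: "S \<in> carrier_mat n n"
    and bound: "\<And>x. x \<in> carrier_vec n \<Longrightarrow> Re ((S *\<^sub>v x) \<bullet>c (S *\<^sub>v x)) \<le> s * Re (x \<bullet>c x)"
    and j: "j < n"
  shows "\<bar>eigval (Suc j) (mat_adjoint S * E * S)\<bar> \<le> s * \<bar>eigval (Suc j) E\<bar>"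
proof -
  define M where "M = mat_adjoint S * E * S"
  have M: "M \<in> carrier_mat n n" "hermitian_mat M"
    using E S hermitian_mat_congruence[OF E S] by (auto simp: M_def)
  define d f where "d i = eigval (Suc i) M" and "f i = eigval (Suc i) E" for i
  let ?D = "mat_diag n (\<lambda>j. complex_of_real (d j))" and ?F = "mat_diag n (\<lambda>j. complex_of_real (f j))"
  from hermitian_spectral_decomposition[OF M] obtain X where
    X: "X \<in> carrier_mat n n" "unitary_mat X" and MX: "M = X * ?D * mat_adjoint X"
    unfolding d_def by metis
  from hermitian_spectral_decomposition[OF E] obtain W where
    W: "W \<in> carrier_mat n n" "unitary_mat W" and EW: "E = W * ?F * mat_adjoint W"
    unfolding f_def by metis
  define Q where "Q = mat_adjoint W * S * X"
  have Q: "Q \<in> carrier_mat n n" using W X S by (simp add: Q_def)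
  have F: "?F \<in> carrier_mat n n" by simp
  have "?D = mat_adjoint X * M * X"
    using unitary_diagonalization_inverse[OF X] MX by simp
  also have "\<dots> = mat_adjoint Q * ?F * Q"
    unfolding M_def EW Q_def using W X S F
    by (simp add: assoc_mult_mat[of _ n n _ n _ n] mat_adjoint_mult[of _ n n _ n])
  finally have D: "?D = mat_adjoint Q * ?F * Q" .
  have Qbound: "Re ((Q *\<^sub>v x) \<bullet>c (Q *\<^sub>v x)) \<le> s * Re (x \<bullet>c x)" if x: "x \<in> carrier_vec n" for x
  proof -
    have "Q *\<^sub>v x = mat_adjoint W *\<^sub>v (S *\<^sub>v (X *\<^sub>v x))"
      using W X S x by (simp add: Q_def assoc_mult_mat_vec[of _ n n _ n])
    hence "(Q *\<^sub>v x) \<bullet>c (Q *\<^sub>v x) = (S *\<^sub>v (X *\<^sub>v x)) \<bullet>c (S *\<^sub>v (X *\<^sub>v x))"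
      using W X S x unitary_mat_isometry[OF mat_adjoint_carrier[OF W(1)] unitary_mat_adjoint[OF W]] by simp
    thus ?thesis using bound[of "X *\<^sub>v x"] unitary_mat_isometry[OF X x] X x by simp
  qed
  have dmono: "d i \<le> d l" if "l \<le> i" "i < n" for l i
    using eigval_antimono[OF M(1) that] by (simp add: d_def)
  have fmono: "f i \<le> f l" if "l \<le> i" "i < n" for l i
    using eigval_antimono[OF E(1) that] by (simp add: f_def)
  \<comment> \<open>Testing the norm bound on a unit vector shows that \<open>s\<close> is nonnegative.\<close>
  have "0 \<le> Re ((S *\<^sub>v unit_vec n j) \<bullet>c (S *\<^sub>v unit_vec n j))"
    by (simp add: cscalar_prod_self_of_real sum_nonneg)
  also have "\<dots> \<le> s * Re (unit_vec n j \<bullet>c unit_vec n j)"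
    by (rule bound) simp
  finally have s: "0 \<le> s"
    using j by simp
  consider "0 < d j" | "d j = 0" | "d j < 0" by linarith
  hence "\<bar>d j\<bar> \<le> s * \<bar>f j\<bar>"
  proof cases
    case 1
    have "d j \<le> s * f j"
      by (rule diagonal_congruence_bound[OF Q D Qbound, of "{..j}" "{..<j}"])
         (use j 1 dmono fmono in auto)
    also have "\<dots> \<le> s * \<bar>f j\<bar>" using s by (intro mult_left_mono) auto
    finally show ?thesis using 1 by simp
  next
    case 2
    thus ?thesis using s by simp
  next
    case 3
    have neg: "mat_diag n (\<lambda>j. complex_of_real (- g j)) = - mat_diag n (\<lambda>j. complex_of_real (g j))" for g
      by (intro eq_matI) (auto simp: mat_diag_def)
    have D': "mat_diag n (\<lambda>j. complex_of_real (- d j))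
        = mat_adjoint Q * mat_diag n (\<lambda>j. complex_of_real (- f j)) * Q"
      unfolding neg D using Q F by (simp add: uminus_mult_left_mat uminus_mult_right_mat)
    have "- d j \<le> s * (- f j)"
      by (rule diagonal_congruence_bound[OF Q D' Qbound, of "{j..<n}" "{Suc j..<n}"])
         (use j 3 dmono fmono in auto)
    also have "\<dots> \<le> s * \<bar>f j\<bar>" using s by (intro mult_left_mono) auto
    finally show ?thesis using 3 by simp
  qed
  thus ?thesis by (simp add: d_def f_def M_def)
qed

lemma unitary_diagonalization_bound:
  assumes V: "V \<in> carrier_mat n n" "unitary_mat V" and x: "x \<in> carrier_vec n"
    and t: "\<And>j. j < n \<Longrightarrow> (cmod (t j))\<^sup>2 \<le> s"
  defines "S \<equiv> V * mat_diag n t * mat_adjoint V"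
  shows "Re ((S *\<^sub>v x) \<bullet>c (S *\<^sub>v x)) \<le> s * Re (x \<bullet>c x)"
proof -
  define y where "y = mat_adjoint V *\<^sub>v x"
  have y: "y \<in> carrier_vec n" using V x by (simp add: y_def)
  have T: "mat_diag n t \<in> carrier_mat n n" by simp
  have "S *\<^sub>v x = V *\<^sub>v (mat_diag n t *\<^sub>v y)"
    using V x T by (simp add: S_def y_def assoc_mult_mat_vec[of _ n n _ n])
  hence "(S *\<^sub>v x) \<bullet>c (S *\<^sub>v x) = (mat_diag n t *\<^sub>v y) \<bullet>c (mat_diag n t *\<^sub>v y)"
    using unitary_mat_isometry[OF V] T y by simp
  hence "Re ((S *\<^sub>v x) \<bullet>c (S *\<^sub>v x)) = (\<Sum>j<n. (cmod (t j))\<^sup>2 * (cmod (y $ j))\<^sup>2)"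
    using y by (simp add: cscalar_prod_self_of_real mat_diag_mult_vec norm_mult power_mult_distrib)
  also have "\<dots> \<le> (\<Sum>j<n. s * (cmod (y $ j))\<^sup>2)"
    using t by (intro sum_mono mult_right_mono) auto
  also have "\<dots> = s * Re (y \<bullet>c y)"
    using y by (simp add: cscalar_prod_self_of_real sum_distrib_left)
  also have "y \<bullet>c y = x \<bullet>c x"
    using unitary_mat_isometry[OF _ unitary_mat_adjoint[OF V] x] V by (simp add: y_def)
  finally show ?thesis .
qed

section \<open>The spectral norm\<close>

lemma spectrum_unitary_diagonalization:
  assumes V: "V \<in> carrier_mat n n" "unitary_mat V"
  shows "spectrum (V * mat_diag n d * mat_adjoint V) = d ` {..<n}"
proof -
  have "V * mat_diag n d * mat_adjoint V \<in> carrier_mat n n" using V by auto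
  from spectrum_root_char_poly[OF this] show ?thesis
    unfolding char_poly_unitary_diagonalization[OF V]
    by (auto simp: poly_prod_list prod_list_zero_iff)
qed

text \<open>\<open>W diag(g) X\<close> is a singular value decomposition up to phases, because its Gram matrix is
\<open>X\<^sup>* diag(\<bar>g\<bar>\<^sup>2) X\<close>.\<close>

lemma mat_norm2_unitary_diag:
  assumes W: "W \<in> carrier_mat n n" "unitary_mat W" and X: "X \<in> carrier_mat n n" "unitary_mat X"
  shows "mat_norm2 (W * mat_diag n g * X) = Max ((\<lambda>j. cmod (g j)) ` {..<n})"
proof -
  let ?G = "mat_diag n g" and ?G' = "mat_diag n (\<lambda>j. cnj (g j))"
  have G: "?G \<in> carrier_mat n n" "?G' \<in> carrier_mat n n" by auto
  have "mat_adjoint (W * ?G * X) * (W * ?G * X) = mat_adjoint X * (?G' * ?G) * X"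
    using W X G
    by (simp add: assoc_mult_mat[of _ n n _ n _ n] mat_adjoint_mult[of _ n n _ n]
        unitary_mat_cancel[of _ n _ n] del: mat_diag_diag)
  also have "\<dots> = mat_adjoint X * mat_diag n (\<lambda>j. cnj (g j) * g j) * mat_adjoint (mat_adjoint X)"
    by simp
  finally have "spectrum (mat_adjoint (W * ?G * X) * (W * ?G * X)) = (\<lambda>j. cnj (g j) * g j) ` {..<n}"
    using spectrum_unitary_diagonalization[OF _ unitary_mat_adjoint[OF X]] X(1) by simp
  hence "singular_values (W * ?G * X) = (\<lambda>j. sqrt (Re (cnj (g j) * g j))) ` {..<n}"
    unfolding singular_values_def by (simp add: image_image)
  also have "(\<lambda>j. sqrt (Re (cnj (g j) * g j))) = (\<lambda>j. cmod (g j))"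
    by (auto simp: cmod_def power2_eq_square)
  finally show ?thesis by (simp add: mat_norm2_def)
qed

section \<open>Roots and inverses of unitarily diagonalized matrices\<close>

text \<open>A function of a normal matrix does not depend on the diagonalization. With \<open>G = W\<^sup>* V\<close> the hypothesis
reads \<open>y\<^sub>i G\<^sub>i\<^sub>j = G\<^sub>i\<^sub>j b\<^sub>j\<close>; so \<open>y\<^sub>i = b\<^sub>j\<close>, and hence \<open>f y\<^sub>i = f b\<^sub>j\<close>, wherever \<open>G\<^sub>i\<^sub>j \<noteq> 0\<close>.\<close>

lemma functional_calculus_well_defined:
  assumes V: "V \<in> carrier_mat n n" "unitary_mat V" and W: "W \<in> carrier_mat n n" "unitary_mat W"
    and eq: "W * mat_diag n y * mat_adjoint W = V * mat_diag n b * mat_adjoint V"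
  shows "W * mat_diag n (\<lambda>j. f (y j)) * mat_adjoint W = V * mat_diag n (\<lambda>j. f (b j)) * mat_adjoint V"
proof -
  define G where "G = mat_adjoint W * V"
  have G: "G \<in> carrier_mat n n" using V W by (simp add: G_def)
  have c: "mat_diag n h \<in> carrier_mat n n" for h :: "nat \<Rightarrow> complex" by simp
  have "mat_diag n y * G = mat_adjoint W * (W * mat_diag n y * mat_adjoint W) * V"
    using V W c by (simp add: G_def assoc_mult_mat[of _ n n _ n _ n] unitary_mat_cancel[of _ n _ n])
  also have "\<dots> = G * mat_diag n b"
    unfolding eq using V W c unitary_matD[OF V]
    by (simp add: G_def assoc_mult_mat[of _ n n _ n _ n])
  finally have yb: "mat_diag n y * G = G * mat_diag n b" .
  have "f (y i) * G $$ (i,j) = G $$ (i,j) * f (b j)" if "i < n" "j < n" for i j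
  proof -
    have "y i * G $$ (i,j) = G $$ (i,j) * b j"
      using arg_cong[OF yb, of "\<lambda>X. X $$ (i,j)"] that
      by (simp add: mat_diag_mult_left[OF G] mat_diag_mult_right[OF G])
    thus ?thesis by (cases "G $$ (i,j) = 0") auto
  qed
  hence "mat_diag n (\<lambda>j. f (y j)) * G = G * mat_diag n (\<lambda>j. f (b j))"
    unfolding mat_diag_mult_left[OF G] mat_diag_mult_right[OF G] by (intro eq_matI) auto
  hence "W * (mat_diag n (\<lambda>j. f (y j)) * G) * mat_adjoint V = W * (G * mat_diag n (\<lambda>j. f (b j))) * mat_adjoint V"
    by simp
  thus ?thesis using V W c unitary_matD[OF V]
    by (simp add: G_def assoc_mult_mat[of _ n n _ n _ n] unitary_mat_cancel[of _ n _ n])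
qed

text \<open>The quadratic form takes the value \<open>y j\<close> at the \<open>j\<close>-th column of \<open>V\<close>.\<close>

lemma pos_def_mat_eigval_pos:
  assumes V: "V \<in> carrier_mat n n" "unitary_mat V"
    and pd: "pos_def_mat (V * mat_diag n (\<lambda>j. complex_of_real (y j)) * mat_adjoint V)" and j: "j < n"
  shows "0 < y j"
proof -
  let ?Y = "mat_diag n (\<lambda>j. complex_of_real (y j))"
  define v where "v = V *\<^sub>v unit_vec n j"
  have Y: "?Y \<in> carrier_mat n n" by simp
  have v: "v \<in> carrier_vec n" using V by (simp add: v_def)
  have Vv: "mat_adjoint V *\<^sub>v v = unit_vec n j"
    using V unitary_matD[OF V] by (simp add: v_def assoc_mult_mat_vec[of _ n n _ n, symmetric])
  have "v \<noteq> 0\<^sub>v n"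
  proof
    assume "v = 0\<^sub>v n"
    moreover have "mat_adjoint V *\<^sub>v 0\<^sub>v n = 0\<^sub>v n" using V by (intro eq_vecI) auto
    ultimately have "unit_vec n j = (0\<^sub>v n :: complex vec)" using Vv by simp
    from arg_cong[OF this, of "\<lambda>x. x $ j"] show False using j by simp
  qed
  hence "0 < Re (((V * ?Y * mat_adjoint V) *\<^sub>v v) \<bullet>c v)"
    using pd v V by (auto simp: pos_def_mat_def)
  also have "((V * ?Y * mat_adjoint V) *\<^sub>v v) \<bullet>c v = (V *\<^sub>v (?Y *\<^sub>v unit_vec n j)) \<bullet>c v"
    using V Y v Vv by (simp add: assoc_mult_mat_vec[of _ n n _ n])
  also have "\<dots> = (?Y *\<^sub>v unit_vec n j) \<bullet>c unit_vec n j"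
    using V Y v Vv by (subst cscalar_prod_adjoint[of _ n n]) auto
  also have "\<dots> = complex_of_real (\<Sum>i<n. y i * (cmod (unit_vec n j $ i))\<^sup>2)"
    by (rule mat_diag_form) simp
  also have "(\<Sum>i<n. y i * (cmod (unit_vec n j $ i))\<^sup>2) = (\<Sum>i<n. if i = j then y j else 0)"
    by (intro sum.cong) (auto simp: unit_vec_def)
  finally show ?thesis using j by simp
qed

text \<open>The square root of the polar factor is the positive definite fourth root of \<open>A\<^sup>* A\<close>, so its
diagonalization can be read off from that of \<open>A\<close>. The functional calculus with the real fourth root
gives this in one step, without diagonalizing the polar factor itself.\<close>

lemma pos_def_fourth_root_unique:
  assumes V: "V \<in> carrier_mat n n" "unitary_mat V"
    and R: "R \<in> carrier_mat n n" "pos_def_mat R"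
    and b: "\<And>j. 0 \<le> b j"
    and R4: "(R * R) * (R * R) = V * mat_diag n (\<lambda>j. complex_of_real (b j ^ 4)) * mat_adjoint V"
  shows "R = V * mat_diag n (\<lambda>j. complex_of_real (b j)) * mat_adjoint V"
proof -
  have hR: "hermitian_mat R" using R by (simp add: pos_def_mat_def)
  obtain y W where W: "W \<in> carrier_mat n n" "unitary_mat W"
    and RW: "R = W * mat_diag n (\<lambda>j. complex_of_real (y j)) * mat_adjoint W"
    using hermitian_spectral_decomposition[OF R(1) hR] by metis
  have y: "0 < y j" if "j < n" for j
    using pos_def_mat_eigval_pos[OF W _ that] R(2) RW by simp
  have "W * mat_diag n (\<lambda>j. complex_of_real (y j ^ 4)) * mat_adjoint W = (R * R) * (R * R)"
    unfolding RW unitary_diagonalization_mult[OF W] by (simp add: power4_eq_xxxx mult.assoc)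
  note functional_calculus_well_defined[OF V W this[unfolded R4], of "\<lambda>z. complex_of_real (root 4 (Re z))"]
  moreover have "mat_diag n (\<lambda>j. complex_of_real (root 4 (Re (complex_of_real (y j ^ 4)))))
      = mat_diag n (\<lambda>j. complex_of_real (y j))"
    using y by (intro eq_matI) (auto simp: mat_diag_def real_root_power_cancel less_imp_le simp del: of_real_power)
  moreover have "(\<lambda>j. complex_of_real (root 4 (Re (complex_of_real (b j ^ 4))))) = (\<lambda>j. complex_of_real (b j))"
    using b by (auto simp: real_root_power_cancel simp del: of_real_power)
  ultimately show ?thesis unfolding RW by simp
qed

text \<open>Conjugating by \<open>V\<close> turns the inverse relation into \<open>diag(g) (V\<^sup>* Y V) = 1\<close>, whose diagonal entries force
\<open>g j \<noteq> 0\<close>.\<close>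

lemma mat_inverse_of_unitary_diagonalization:
  assumes V: "V \<in> carrier_mat n n" "unitary_mat V"
    and inv: "mat_inverse_of (V * mat_diag n g * mat_adjoint V) Y"
  shows "\<And>j. j < n \<Longrightarrow> g j \<noteq> 0"
    and "Y = V * mat_diag n (\<lambda>j. inverse (g j)) * mat_adjoint V"
proof -
  let ?B = "V * mat_diag n g * mat_adjoint V"
  have c: "mat_diag n h \<in> carrier_mat n n" for h :: "nat \<Rightarrow> complex" by simp
  have B: "?B \<in> carrier_mat n n" using V by simp
  have 1: "?B * Y = 1\<^sub>m n" and 2: "Y * ?B = 1\<^sub>m (dim_row Y)"
    using inv V B by (auto simp: mat_inverse_of_def inverts_mat_def)
  have Y: "Y \<in> carrier_mat n n"
    using arg_cong[OF 1, of dim_col] arg_cong[OF 2, of dim_col] V by (intro carrier_matI) auto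
  define Z where "Z = mat_adjoint V * Y * V"
  have Z: "Z \<in> carrier_mat n n" using V Y by (simp add: Z_def)
  have "mat_diag n g * Z = mat_adjoint V * (?B * Y) * V"
    using V Y c by (simp add: Z_def assoc_mult_mat[of _ n n _ n _ n] unitary_mat_cancel[of _ n _ n])
  also have "\<dots> = 1\<^sub>m n" unfolding 1 using V unitary_matD[OF V] by simp
  finally have gZ: "mat_diag n g * Z = 1\<^sub>m n" .
  show g: "g j \<noteq> 0" if "j < n" for j
    using arg_cong[OF gZ, of "\<lambda>X. X $$ (j,j)"] that by (auto simp: mat_diag_mult_left[OF Z])
  have "mat_diag n (\<lambda>j. inverse (g j)) * mat_diag n g = 1\<^sub>m n"
    unfolding mat_diag_diag using g by (intro eq_matI) (auto simp: mat_diag_def)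
  hence "Z = mat_diag n (\<lambda>j. inverse (g j)) * (mat_diag n g * Z)"
    using Z c by (simp add: assoc_mult_mat[of _ n n _ n _ n, symmetric] del: mat_diag_diag)
  hence "Z = mat_diag n (\<lambda>j. inverse (g j))" unfolding gZ using c by simp
  moreover have "Y = V * Z * mat_adjoint V"
    using V Y unitary_matD[OF V]
    by (simp add: Z_def assoc_mult_mat[of _ n n _ n _ n] unitary_mat_cancel[of _ n _ n])
  ultimately show "Y = V * mat_diag n (\<lambda>j. inverse (g j)) * mat_adjoint V" by simp
qed

lemma unitary_mat_unitary_diagonalization:
  assumes V: "V \<in> carrier_mat n n" "unitary_mat V" and u: "\<And>j. j < n \<Longrightarrow> cmod (u j) = 1"
  shows "unitary_mat (V * mat_diag n u * mat_adjoint V)"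
proof (rule unitary_matI)
  show "V * mat_diag n u * mat_adjoint V \<in> carrier_mat n n" using V by simp
  have "mat_diag n (\<lambda>j. cnj (u j) * u j) = 1\<^sub>m n"
    using u by (intro eq_matI) (auto simp: mat_diag_def complex_norm_square[symmetric] mult.commute[of "cnj _"])
  thus "mat_adjoint (V * mat_diag n u * mat_adjoint V) * (V * mat_diag n u * mat_adjoint V) = 1\<^sub>m n"
    unfolding mat_adjoint_unitary_diagonalization[OF V(1)] unitary_diagonalization_mult[OF V]
    using V unitary_matD[OF V] by simp
qed

section \<open>The perturbation bound\<close>

theorem theorem3p2:
  fixes A P E P_half P_inv_half A_half A_inv_half :: "complex mat"
    and n i j' :: nat and k :: real
  assumes "A \<in> carrier_mat n n" and "hermitian_mat A" and "invertible_mat A"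
    and "E \<in> carrier_mat n n" and "hermitian_mat E"
    and "polar_factor A P"
    and "pos_def_sqrt P P_half" and "mat_inverse_of P_half P_inv_half"
    and "normal_sqrt A A_half" and "mat_inverse_of A_half A_inv_half"
    and "j' \<in> {1..n}"
    and "\<bar>eigval j' (P_inv_half * E * P_inv_half)\<bar>
           = Max ((\<lambda>j. \<bar>eigval j (P_inv_half * E * P_inv_half)\<bar>) ` {1..n})"
    and "k = mat_norm2 (A_inv_half * E * A_inv_half)"
    and "i \<in> {1..n}"
    and "\<bar>eigval i A\<bar> / Min ((\<lambda>l. \<bar>eigval l A\<bar>) ` {1..n}) * \<bar>eigval j' E\<bar> \<le> mat_norm2 E"
  shows "k * \<bar>eigval i A\<bar> \<le> mat_norm2 E"
proof -
  note A = assms(1,2) and E = assms(4,5)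
  define S where "S = P_inv_half"
  define N where "N = A_inv_half"
  define M where "M = S * E * S"
  from assms(9) A(1) obtain V d r where V: "V \<in> carrier_mat n n" "unitary_mat V"
    and AV: "A = V * mat_diag n d * mat_adjoint V"
    and rd: "\<And>j. j < n \<Longrightarrow> (r j)\<^sup>2 = d j"
    and AhV: "A_half = V * mat_diag n r * mat_adjoint V"
    unfolding normal_sqrt_def by auto
  have r0: "r j \<noteq> 0" if "j < n" for j
    using mat_inverse_of_unitary_diagonalization(1)[OF V _ that] assms(10) AhV by simp
  have NV: "N = V * mat_diag n (\<lambda>j. inverse (r j)) * mat_adjoint V"
    using mat_inverse_of_unitary_diagonalization(2)[OF V] assms(10) AhV by (simp add: N_def)
  have Ph: "pos_def_mat P_half" "P_half * P_half = P" and PP: "P * P = mat_adjoint A * A"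
    using assms(6,7) by (auto simp: polar_factor_def pos_def_sqrt_def)
  have "P_half \<in> carrier_mat n n"
  proof (rule carrier_matI)
    have "dim_row P_half = dim_row (P * P)" using Ph(2) by auto
    thus "dim_row P_half = n" using PP A(1) by simp
    thus "dim_col P_half = n" using Ph(1) by (simp add: pos_def_mat_def hermitian_mat_def)
  qed
  moreover have "(P_half * P_half) * (P_half * P_half)
      = V * mat_diag n (\<lambda>j. complex_of_real (cmod (r j) ^ 4)) * mat_adjoint V"
  proof -
    have "mat_diag n (\<lambda>j. cnj (d j) * d j) = mat_diag n (\<lambda>j. complex_of_real (cmod (r j) ^ 4))"
    proof (intro eq_matI)
      fix a b assume "a < dim_row (mat_diag n (\<lambda>j. complex_of_real (cmod (r j) ^ 4)))"
        "b < dim_col (mat_diag n (\<lambda>j. complex_of_real (cmod (r j) ^ 4)))"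
      hence ab: "a < n" "b < n" by (auto simp: mat_diag_def)
      have "cnj (d b) * d b = complex_of_real ((cmod (d b))\<^sup>2)"
        using complex_norm_square[of "d b"] by (simp add: mult.commute)
      also have "cmod (d b) = (cmod (r b))\<^sup>2"
        unfolding rd[OF ab(2), symmetric] by (simp add: norm_power)
      finally show "mat_diag n (\<lambda>j. cnj (d j) * d j) $$ (a,b)
          = mat_diag n (\<lambda>j. complex_of_real (cmod (r j) ^ 4)) $$ (a,b)"
        using ab by (simp add: mat_diag_def)
    qed (auto simp: mat_diag_def)
    thus ?thesis
      unfolding Ph(2) PP AV mat_adjoint_unitary_diagonalization[OF V(1)] unitary_diagonalization_mult[OF V]
      by simp
  qed
  ultimately have RV: "P_half = V * mat_diag n (\<lambda>j. complex_of_real (cmod (r j))) * mat_adjoint V"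
    using pos_def_fourth_root_unique[OF V _ Ph(1), of "\<lambda>j. cmod (r j)"] by simp
  define t where "t j = inverse (complex_of_real (cmod (r j)))" for j
  have SV: "S = V * mat_diag n t * mat_adjoint V"
    using mat_inverse_of_unitary_diagonalization(2)[OF V] assms(8) RV by (simp add: S_def t_def[abs_def])
  have S: "S \<in> carrier_mat n n" using V SV by simp
  have aS: "mat_adjoint S = S"
    unfolding SV mat_adjoint_unitary_diagonalization[OF V(1)] by (simp add: t_def[abs_def])
  have M: "M \<in> carrier_mat n n" "hermitian_mat M"
    using hermitian_mat_congruence[OF E S] S E unfolding aS M_def by auto
  \<comment> \<open>\<open>U\<close> carries the phases of \<open>1 / r j\<close>: it is unitary and commutes with \<open>S\<close>.\<close>
  define u where "u j = complex_of_real (cmod (r j)) / r j" for j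
  define U where "U = V * mat_diag n u * mat_adjoint V"
  have U: "U \<in> carrier_mat n n" "unitary_mat U"
    using V unitary_mat_unitary_diagonalization[OF V, of u] r0 by (auto simp: U_def u_def norm_divide)
  have "mat_diag n (\<lambda>j. inverse (r j)) = mat_diag n (\<lambda>j. u j * t j)"
    using r0 by (intro eq_matI) (auto simp: mat_diag_def u_def t_def field_simps)
  hence NUS: "N = U * S" and NSU: "N = S * U"
    unfolding NV U_def SV unitary_diagonalization_mult[OF V] by (simp_all add: mult.commute)
  have NEN: "N * E * N = U * M * U"
    using U S E by (subst NUS, subst NSU) (simp add: M_def assoc_mult_mat[of _ n n _ n _ n])
  obtain X where X: "X \<in> carrier_mat n n" "unitary_mat X"
    and MX: "M = X * mat_diag n (\<lambda>j. complex_of_real (eigval (Suc j) M)) * mat_adjoint X"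
    using hermitian_spectral_decomposition[OF M] by metis
  have "mat_norm2 (U * M * U) = mat_norm2 ((U * X) * mat_diag n (\<lambda>j. complex_of_real (eigval (Suc j) M)) * (mat_adjoint X * U))"
    using U X mat_diag_dim[of n "\<lambda>j. complex_of_real (eigval (Suc j) M)"]
    by (subst MX) (simp add: assoc_mult_mat[of _ n n _ n _ n])
  also have "\<dots> = Max ((\<lambda>j. \<bar>eigval (Suc j) M\<bar>) ` {..<n})"
    using U X by (subst mat_norm2_unitary_diag) (auto intro: unitary_mat_mult[of _ n] unitary_mat_adjoint[of _ n])
  also have "\<dots> = Max ((\<lambda>j. \<bar>eigval j M\<bar>) ` {1..n})"
    unfolding image_Suc_lessThan[symmetric] image_image ..
  finally have k: "k = \<bar>eigval j' M\<bar>"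
    using assms(12,13) NEN by (simp add: M_def S_def N_def)
  \<comment> \<open>The largest eigenvalue of \<open>S\<^sup>* S\<close> is \<open>1 / m\<close>.\<close>
  define m where "m = Min ((\<lambda>l. \<bar>eigval l A\<bar>) ` {1..n})"
  have dr: "complex_of_real (Re (d j)) = d j" if "j < n" for j
    using hermitian_unitary_diagonalization_real[OF V _ that] A(2) AV by simp
  have absd: "\<bar>Re (d j)\<bar> = (cmod (r j))\<^sup>2" if "j < n" for j
  proof -
    have "\<bar>Re (d j)\<bar> = cmod (d j)" by (subst (2) dr[OF that, symmetric]) simp
    thus ?thesis unfolding rd[OF that, symmetric] by (simp add: norm_power)
  qed
  have "(\<lambda>l. \<bar>eigval l A\<bar>) ` {1..n} = abs ` (\<lambda>l. eigval l A) ` {1..n}"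
    by (simp add: image_image)
  also have "\<dots> = (\<lambda>j. \<bar>Re (d j)\<bar>) ` {..<n}"
    unfolding AV eigval_image_unitary_diagonalization[OF V] by (simp add: image_image)
  also have "\<dots> = (\<lambda>j. (cmod (r j))\<^sup>2) ` {..<n}"
    using absd by (intro image_cong) auto
  finally have m: "m = Min ((\<lambda>j. (cmod (r j))\<^sup>2) ` {..<n})" by (simp add: m_def)
  have "n > 0" using assms(11) by auto
  hence "m \<in> (\<lambda>j. (cmod (r j))\<^sup>2) ` {..<n}"
    unfolding m by (intro Min_in) auto
  hence m0: "0 < m" using r0 by auto
  have t_le: "(cmod (t j))\<^sup>2 \<le> 1 / m" if "j < n" for j
  proof -
    have "m \<le> (cmod (r j))\<^sup>2" unfolding m using that by (intro Min_le) auto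
    moreover have "(cmod (t j))\<^sup>2 = 1 / (cmod (r j))\<^sup>2"
      by (simp add: t_def norm_inverse power_inverse divide_inverse)
    ultimately show ?thesis using m0 by (simp add: frac_le)
  qed
  have "Re ((S *\<^sub>v x) \<bullet>c (S *\<^sub>v x)) \<le> 1 / m * Re (x \<bullet>c x)" if "x \<in> carrier_vec n" for x
    unfolding SV by (rule unitary_diagonalization_bound[OF V that t_le])
  moreover have "j' - 1 < n" and "Suc (j' - 1) = j'" using assms(11) by auto
  ultimately have "\<bar>eigval j' (mat_adjoint S * E * S)\<bar> \<le> 1 / m * \<bar>eigval j' E\<bar>"
    using ostrowski_abs_eigval_congruence[OF E S, of "1 / m" "j' - 1"] by simp
  hence "k \<le> 1 / m * \<bar>eigval j' E\<bar>"
    unfolding aS by (simp add: k M_def)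
  hence "k * \<bar>eigval i A\<bar> \<le> (1 / m * \<bar>eigval j' E\<bar>) * \<bar>eigval i A\<bar>"
    by (rule mult_right_mono) simp
  also have "\<dots> = \<bar>eigval i A\<bar> / m * \<bar>eigval j' E\<bar>" by simp
  also have "\<dots> \<le> mat_norm2 E" using assms(15) by (simp add: m_def)
  finally show ?thesis .
qed

end
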